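(* Let $R$ be an $n$-CH algebra (over a field of characteristic $0$) with trace algebra $T$. Then the map $j:\mathrm{Spec}_t(R)\to\mathrm{Spec}(T)$, $P\mapsto P\cap T$, is a homeomorphism, and its inverse is $\mathfrak p\mapsto K(\mathfrak pR)$.
   Context: An algebra with trace is an associative unital algebra $R$ over a field with a linear map $t:R\to R$ such that $t(a)b=b\,t(a)$, $t(ab)=t(ba)$, $t(t(a)b)=t(a)t(b)$ for all $a,b\in R$. The commutative central subalgebra $T=t(R)$ is the trace algebra of $R$. A trace ideal is a two-sided ideal $I$ with $t(I)\subset I$; then $R/I$ is again an algebra with trace. A trace algebra is prime if it is nonzero and, for trace ideals $I,J$, $IJ=0$ implies $I=0$ or $J=0$. A trace ideal $P$ is a prime trace ideal if $R/P$ is a prime trace algebra. $\mathrm{Spec}_t(R)$ is the set of prime trace ideals of $R$, with the Zariski topology, whose closed sets are $\{P\mid P\supset I\}$ for trace ideals $I$ of $R$; $\mathrm{Spec}(T)$ is the usual prime spectrum of the commutative ring $T$ with the Zariski topology. For a trace algebra $R$ put $K_R:=\{x\in R\mid t(xy)=0\ \forall y\in R\}$. For a trace ideal $I$ of $R$, the radical kernel $K(I)\supset I$ is the ideal with $K(I)/I=K_{R/I}$, i.e. $K(I)=\{x\in R\mid t(xy)\in I\ \forall y\in R\}$. (For an ideal $\mathfrak p$ of $T$, $\mathfrak pR$ is a trace ideal.) In characteristic $0$ define $\sigma_i(x)$ by $\sum_{i\ge 0}(-1)^i\sigma_i(x)u^i=\exp\bigl(-\sum_{j\ge1}\frac{t(x^j)}{j}u^j\bigr)$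 and $CH_n(x):=x^n+\sum_{i=1}^n(-1)^i\sigma_i(x)x^{n-i}$. An $n$-Cayley–Hamilton algebra ($n$-CH algebra) is an algebra with trace with $t(1)=n$ and $CH_n(a)=0$ for all $a$ (equivalently, satisfying the full polarization of $CH_n$). *)

theory Defs
  imports "HOL-Algebra.QuotRing" "HOL-Algebra.Ideal_Product" "HOL-Algebra.Module"
    "HOL-Analysis.Abstract_Topology"
begin

subsection \<open>Algebras with trace\<close>

locale assoc_algebra = Module.module F R + F: Ring.field F + M?: Ring.ring R
  for F and R (structure) +
  assumes smult_mult_left:
      "\<lbrakk>c \<in> carrier F; x \<in> carrier R; y \<in> carrier R\<rbrakk> \<Longrightarrow>
        (c \<odot> x) \<otimes> y = c \<odot> (x \<otimes> y)"
    and smult_mult_right: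
      "\<lbrakk>c \<in> carrier F; x \<in> carrier R; y \<in> carrier R\<rbrakk> \<Longrightarrow>
        x \<otimes> (c \<odot> y) = c \<odot> (x \<otimes> y)"

locale trace_algebra = assoc_algebra F R
  for F and R (structure) +
  fixes t
  assumes tr_closed [simp, intro]: "x \<in> carrier R \<Longrightarrow> t x \<in> carrier R"
    and tr_add: "\<lbrakk>x \<in> carrier R; y \<in> carrier R\<rbrakk> \<Longrightarrow> t (x \<oplus> y) = t x \<oplus> t y"
    and tr_smult: "\<lbrakk>c \<in> carrier F; x \<in> carrier R\<rbrakk> \<Longrightarrow> t (c \<odot> x) = c \<odot> t x"
    and tr_central: "\<lbrakk>x \<in> carrier R; y \<in> carrier R\<rbrakk> \<Longrightarrow> t x \<otimes> y = y \<otimes> t x"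
    and tr_commute: "\<lbrakk>x \<in> carrier R; y \<in> carrier R\<rbrakk> \<Longrightarrow> t (x \<otimes> y) = t (y \<otimes> x)"
    and tr_mult_tr: "\<lbrakk>x \<in> carrier R; y \<in> carrier R\<rbrakk> \<Longrightarrow> t (t x \<otimes> y) = t x \<otimes> t y"

definition trace_ring :: "('a, 'm) ring_scheme \<Rightarrow> ('a \<Rightarrow> 'a) \<Rightarrow> ('a, 'm) ring_scheme" where
  "trace_ring R t = R\<lparr>carrier := t ` carrier R\<rparr>"

definition trace_ideal :: "('a, 'm) ring_scheme \<Rightarrow> ('a \<Rightarrow> 'a) \<Rightarrow> 'a set \<Rightarrow> bool" where
  "trace_ideal R t I \<longleftrightarrow> ideal I R \<and> t ` I \<subseteq> I"

text \<open>
  The elements of the quotient are the additive cosets of \<open>I\<close>. As in the library's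
  \<^const>\<open>FactRing\<close>, the induced operations are written as unions over all representatives;
  for a trace ideal \<open>I\<close> the scalar \<open>c\<close> sends \<open>I + x\<close> to \<open>I + c x\<close> and the trace
  sends \<open>I + x\<close> to \<open>I + t x\<close>.
\<close>

definition quot_algebra ::
    "('k, 'a, 'm) module_scheme \<Rightarrow> 'a set \<Rightarrow> ('k, 'a set) module" where
  "quot_algebra R I =
    ring.extend (R Quot I) (module.fields (\<lambda>c C. \<Union>x\<in>C. I +>\<^bsub>R\<^esub> (c \<odot>\<^bsub>R\<^esub> x)))"

definition quot_trace :: "('a, 'm) ring_scheme \<Rightarrow> ('a \<Rightarrow> 'a) \<Rightarrow> 'a set \<Rightarrow> 'a set \<Rightarrow> 'a set" where
  "quot_trace R t I C = (\<Union>x\<in>C. I +>\<^bsub>R\<^esub> t x)"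

locale prime_trace_algebra = trace_algebra F R t
  for F and R (structure) and t +
  assumes nonzero: "carrier R \<noteq> {\<zero>}"
    and prime:
      "\<lbrakk>trace_ideal R t I; trace_ideal R t J; ideal_prod R I J = {\<zero>}\<rbrakk> \<Longrightarrow>
        I = {\<zero>} \<or> J = {\<zero>}"

definition prime_trace_ideal ::
    "('k, 'l) ring_scheme \<Rightarrow> ('k, 'a, 'm) module_scheme \<Rightarrow> ('a \<Rightarrow> 'a) \<Rightarrow> 'a set \<Rightarrow> bool" where
  "prime_trace_ideal F R t P \<longleftrightarrow>
    trace_ideal R t P \<and> prime_trace_algebra F (quot_algebra R P) (quot_trace R t P)"

definition radical_kernel :: "('a, 'm) ring_scheme \<Rightarrow> ('a \<Rightarrow> 'a) \<Rightarrow> 'a set \<Rightarrow> 'a set" where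
  "radical_kernel R t I = {x \<in> carrier R. \<forall>y \<in> carrier R. t (x \<otimes>\<^bsub>R\<^esub> y) \<in> I}"


subsection \<open>Spectra\<close>

text \<open>
  The topology on \<open>\<S>\<close> whose closed sets are the \<open>{P \<in> \<S>. I \<subseteq> P}\<close> for \<open>I \<in> \<I>\<close>.
  The lemmas \<open>closedin_Spec_t\<close> and \<open>closedin_Spec\<close> below show that this really is a
  topology in both cases where it is used.
\<close>

definition zariski_topology :: "'a set set \<Rightarrow> 'a set set \<Rightarrow> 'a set topology" where
  "zariski_topology \<I> \<S> = topology (\<lambda>U. \<exists>I\<in>\<I>. U = \<S> - {P \<in> \<S>. I \<subseteq> P})"

definition Spec_t ::
    "('k, 'l) ring_scheme \<Rightarrow> ('k, 'a, 'm) module_scheme \<Rightarrow> ('a \<Rightarrow> 'a) \<Rightarrow> 'a set topology" where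
  "Spec_t F R t = zariski_topology {I. trace_ideal R t I} {P. prime_trace_ideal F R t P}"

definition Spec :: "('a, 'm) ring_scheme \<Rightarrow> 'a set topology" where
  "Spec A = zariski_topology {I. ideal I A} {P. primeideal P A}"


subsection \<open>Cayley--Hamilton algebras\<close>

text \<open>
  Formal power series over a ring are represented by their coefficient sequences.
  The exponential below is \<open>\<Sum>m. f\<^sup>m / m!\<close> for a series \<open>f\<close> with zero constant
  term; then \<open>f\<^sup>m\<close> has no terms of degree less than \<open>m\<close>, so only \<open>m \<le> k\<close>
  contribute to the coefficient of degree \<open>k\<close>.
\<close>

definition ps_mult :: "('a, 'm) ring_scheme \<Rightarrow> (nat \<Rightarrow> 'a) \<Rightarrow> (nat \<Rightarrow> 'a) \<Rightarrow> nat \<Rightarrow> 'a" where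
  "ps_mult R f g = (\<lambda>k. \<Oplus>\<^bsub>R\<^esub>i\<in>{..k}. f i \<otimes>\<^bsub>R\<^esub> g (k - i))"

primrec ps_power :: "('a, 'm) ring_scheme \<Rightarrow> (nat \<Rightarrow> 'a) \<Rightarrow> nat \<Rightarrow> nat \<Rightarrow> 'a" where
  "ps_power R f 0 = (\<lambda>k. if k = 0 then \<one>\<^bsub>R\<^esub> else \<zero>\<^bsub>R\<^esub>)"
| "ps_power R f (Suc m) = ps_mult R f (ps_power R f m)"

definition inv_of_nat :: "('k, 'l) ring_scheme \<Rightarrow> nat \<Rightarrow> 'k" where
  "inv_of_nat F m = inv\<^bsub>F\<^esub> ([m] \<cdot>\<^bsub>F\<^esub> \<one>\<^bsub>F\<^esub>)"

definition ps_exp ::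
    "('k, 'l) ring_scheme \<Rightarrow> ('k, 'a, 'm) module_scheme \<Rightarrow> (nat \<Rightarrow> 'a) \<Rightarrow> nat \<Rightarrow> 'a" where
  "ps_exp F R f = (\<lambda>k. \<Oplus>\<^bsub>R\<^esub>m\<in>{..k}. inv_of_nat F (fact m) \<odot>\<^bsub>R\<^esub> ps_power R f m k)"

text \<open>
  The coefficient comparison in
  \<open>\<Sum>i. (-1)\<^sup>i \<sigma>\<^sub>i(x) u\<^sup>i = exp (- (\<Sum>j\<ge>1. t(x\<^sup>j) / j * u\<^sup>j))\<close>,
  solved for \<open>\<sigma>\<^sub>i(x)\<close>.
\<close>

definition sigma ::
    "('k, 'l) ring_scheme \<Rightarrow> ('k, 'a, 'm) module_scheme \<Rightarrow> ('a \<Rightarrow> 'a) \<Rightarrow> nat \<Rightarrow> 'a \<Rightarrow> 'a" where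
  "sigma F R t i x =
    (\<ominus>\<^bsub>R\<^esub> \<one>\<^bsub>R\<^esub>) [^]\<^bsub>R\<^esub> i \<otimes>\<^bsub>R\<^esub>
      ps_exp F R
        (\<lambda>j. if j = 0 then \<zero>\<^bsub>R\<^esub>
              else \<ominus>\<^bsub>R\<^esub> (inv_of_nat F j \<odot>\<^bsub>R\<^esub> t (x [^]\<^bsub>R\<^esub> j))) i"

definition CH ::
    "('k, 'l) ring_scheme \<Rightarrow> ('k, 'a, 'm) module_scheme \<Rightarrow> ('a \<Rightarrow> 'a) \<Rightarrow> nat \<Rightarrow> 'a \<Rightarrow> 'a" where
  "CH F R t n x =
    x [^]\<^bsub>R\<^esub> n \<oplus>\<^bsub>R\<^esub>
      (\<Oplus>\<^bsub>R\<^esub>i\<in>{1..n}.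
        (\<ominus>\<^bsub>R\<^esub> \<one>\<^bsub>R\<^esub>) [^]\<^bsub>R\<^esub> i \<otimes>\<^bsub>R\<^esub> sigma F R t i x \<otimes>\<^bsub>R\<^esub> x [^]\<^bsub>R\<^esub> (n - i))"

locale cayley_hamilton_algebra = trace_algebra F R t
  for F and R (structure) and t +
  fixes n :: nat
  assumes char_zero: "m > 0 \<Longrightarrow> [(m::nat)] \<cdot>\<^bsub>F\<^esub> \<one>\<^bsub>F\<^esub> \<noteq> \<zero>\<^bsub>F\<^esub>"
    and tr_one: "t \<one> = [n] \<cdot> \<one>"
    and CH_zero: "a \<in> carrier R \<Longrightarrow> CH F R t n a = \<zero>"


subsection \<open>The quotient algebra and the Zariski topologies are well defined\<close>

lemma closedin_zariski_topology:
  assumes A: "A \<in> \<I>" "\<And>I. I \<in> \<I> \<Longrightarrow> I \<subseteq> A"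
    and Inter: "\<And>\<F>. \<lbrakk>\<F> \<subseteq> \<I>; \<F> \<noteq> {}\<rbrakk> \<Longrightarrow> \<Inter>\<F> \<in> \<I>"
    and sub: "\<S> \<subseteq> \<I>"
    and A_nin: "A \<notin> \<S>"
    and prime: "\<And>P I J. \<lbrakk>P \<in> \<S>; I \<in> \<I>; J \<in> \<I>; I \<inter> J \<subseteq> P\<rbrakk> \<Longrightarrow> I \<subseteq> P \<or> J \<subseteq> P"
  shows "closedin (zariski_topology \<I> \<S>) C \<longleftrightarrow> (\<exists>I\<in>\<I>. C = {P \<in> \<S>. I \<subseteq> P})"
    and "topspace (zariski_topology \<I> \<S>) = \<S>"
proof -
  let ?op = "\<lambda>U. \<exists>I\<in>\<I>. U = \<S> - {P \<in> \<S>. I \<subseteq> P}"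
  have "istopology ?op"
    unfolding istopology_def
  proof (intro conjI allI impI)
    fix U V assume "?op U" "?op V"
    then obtain I J where IJ: "I \<in> \<I>" "J \<in> \<I>" "U = \<S> - {P \<in> \<S>. I \<subseteq> P}" "V = \<S> - {P \<in> \<S>. J \<subseteq> P}"
      by blast
    have "\<Inter>{I, J} \<in> \<I>" using Inter[of "{I, J}"] IJ by blast
    then have "I \<inter> J \<in> \<I>" by simp
    moreover have "U \<inter> V = \<S> - {P \<in> \<S>. I \<inter> J \<subseteq> P}" using IJ prime by blast
    ultimately show "?op (U \<inter> V)" by blast
  next
    fix \<U> assume *: "\<forall>U\<in>\<U>. ?op U"
    let ?G = "{I \<in> \<I>. \<S> - {P \<in> \<S>. I \<subseteq> P} \<in> \<U>}"
    let ?K = "\<Inter>{J \<in> \<I>. \<Union>?G \<subseteq> J}"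
    have K: "?K \<in> \<I>" by (rule Inter) (use A in blast)+
    have "\<Union>\<U> = \<S> - {P \<in> \<S>. ?K \<subseteq> P}"
    proof (intro equalityI subsetI)
      fix P assume "P \<in> \<Union>\<U>"
      then obtain U where U: "U \<in> \<U>" "P \<in> U" by blast
      obtain I where I: "I \<in> \<I>" "U = \<S> - {P \<in> \<S>. I \<subseteq> P}"
        using bspec[OF * U(1)] by (rule bexE)
      have "I \<in> ?G" using I U(1) by simp
      then have "I \<subseteq> ?K" by (intro Inter_greatest) auto
      moreover have "P \<in> \<S>" "\<not> I \<subseteq> P" using U(2) unfolding I(2) by simp_all
      ultimately show "P \<in> \<S> - {P \<in> \<S>. ?K \<subseteq> P}" by (auto simp del: Inter_iff)
    next
      fix P assume P: "P \<in> \<S> - {P \<in> \<S>. ?K \<subseteq> P}"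
      then have "P \<in> \<I>" using sub by blast
      then have "\<not> \<Union>?G \<subseteq> P" using P by (auto dest: Inter_lower)
      then obtain I where I: "I \<in> ?G" "\<not> I \<subseteq> P" by (meson Union_least)
      have "P \<in> \<S> - {P \<in> \<S>. I \<subseteq> P}" using P I by simp
      then show "P \<in> \<Union>\<U>" using I(1) by (intro UnionI[of "\<S> - {P \<in> \<S>. I \<subseteq> P}"]) simp_all
    qed
    then show "?op (\<Union>\<U>)" using K by blast
  qed
  then have op: "openin (zariski_topology \<I> \<S>) = ?op"
    by (simp add: zariski_topology_def topology_inverse')
  have "\<not> A \<subseteq> P" if "P \<in> \<S>" for P
    using that A_nin A(2)[of P] sub by (metis subsetD subset_antisym)
  then have "?op \<S>" using A(1) by (intro bexI[of _ A]) auto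
  then show top: "topspace (zariski_topology \<I> \<S>) = \<S>"
  proof (intro equalityI)
    show "topspace (zariski_topology \<I> \<S>) \<subseteq> \<S>"
      unfolding topspace_def op by (rule Union_least) (simp, elim bexE, simp)
    show "\<S> \<subseteq> topspace (zariski_topology \<I> \<S>)"
      using \<open>?op \<S>\<close> by (metis op openin_subset)
  qed
  show "closedin (zariski_topology \<I> \<S>) C \<longleftrightarrow> (\<exists>I\<in>\<I>. C = {P \<in> \<S>. I \<subseteq> P})"
  proof
    assume "closedin (zariski_topology \<I> \<S>) C"
    then have C: "C \<subseteq> \<S>" "?op (\<S> - C)" by (simp_all add: closedin_def top op)
    from C(2) obtain I where I: "I \<in> \<I>" "\<S> - C = \<S> - {P \<in> \<S>. I \<subseteq> P}" by (rule bexE)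
    have "C = \<S> - (\<S> - C)" using C(1) by (simp add: double_diff)
    also have "\<dots> = {P \<in> \<S>. I \<subseteq> P}" unfolding I(2) by (simp add: double_diff)
    finally show "\<exists>I\<in>\<I>. C = {P \<in> \<S>. I \<subseteq> P}" using I(1) by (rule bexI)
  next
    assume "\<exists>I\<in>\<I>. C = {P \<in> \<S>. I \<subseteq> P}"
    then obtain I where I: "I \<in> \<I>" "C = {P \<in> \<S>. I \<subseteq> P}" by (rule bexE)
    have "?op (\<S> - C)" unfolding I(2) by (rule bexI[OF refl I(1)])
    then show "closedin (zariski_topology \<I> \<S>) C"
      unfolding closedin_def top op using I(2) by simp
  qed
qed

lemma closedin_Spec:
  assumes "ring A"
  shows "closedin (Spec A) C \<longleftrightarrow> (\<exists>I. ideal I A \<and> C = {P. primeideal P A \<and> I \<subseteq> P})"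
    and "topspace (Spec A) = {P. primeideal P A}"
proof -
  have Inter: "\<Inter>\<F> \<in> {I. ideal I A}" if "\<F> \<subseteq> {I. ideal I A}" "\<F> \<noteq> {}" for \<F>
      using ring.i_Intersect[OF assms, of \<F>] that by blast
  have prime: "I \<subseteq> P \<or> J \<subseteq> P"
      if *: "P \<in> {P. primeideal P A}" "I \<in> {I. ideal I A}" "J \<in> {I. ideal I A}" "I \<inter> J \<subseteq> P"
      for P I J
    proof (rule ccontr)
      assume "\<not> (I \<subseteq> P \<or> J \<subseteq> P)"
      then obtain x y where xy: "x \<in> I" "x \<notin> P" "y \<in> J" "y \<notin> P" by blast
      have c: "x \<in> carrier A" "y \<in> carrier A"
        using xy * ideal.Icarr by fastforce+
      have "x \<otimes>\<^bsub>A\<^esub> y \<in> I \<inter> J"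
        using * xy c by (auto intro: ideal.I_l_closed ideal.I_r_closed)
      then show False using * primeideal.I_prime[of P A x y] c xy by blast
    qed
  have "carrier A \<in> {I. ideal I A}" "I \<subseteq> carrier A" if "I \<in> {I. ideal I A}" for I
    using that ring.oneideal[OF assms] ideal.Icarr by fastforce+
  moreover have "carrier A \<notin> {P. primeideal P A}" "{P. primeideal P A} \<subseteq> {I. ideal I A}"
    using primeideal.I_notcarr primeideal.axioms(1) by fastforce+
  moreover have "carrier A \<in> {I. ideal I A}" using ring.oneideal[OF assms] by simp
  ultimately have
    "closedin (Spec A) C \<longleftrightarrow> (\<exists>I\<in>{I. ideal I A}. C = {P \<in> {P. primeideal P A}. I \<subseteq> P})"
    "topspace (Spec A) = {P. primeideal P A}"
    unfolding Spec_def
    by - (rule closedin_zariski_topology[where A = "carrier A"]; (rule Inter prime)?; simp)+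
  then show "closedin (Spec A) C \<longleftrightarrow> (\<exists>I. ideal I A \<and> C = {P. primeideal P A \<and> I \<subseteq> P})"
    and "topspace (Spec A) = {P. primeideal P A}" by auto
qed

context trace_algebra
begin

lemma trace_idealD:
  assumes "trace_ideal R t I"
  shows "ideal I R" "x \<in> I \<Longrightarrow> t x \<in> I" "x \<in> I \<Longrightarrow> x \<in> carrier R"
proof -
  show *: "ideal I R" using assms by (simp add: trace_ideal_def)
  show "x \<in> I \<Longrightarrow> t x \<in> I" using assms by (auto simp: trace_ideal_def)
  show "x \<in> I \<Longrightarrow> x \<in> carrier R" using ideal.Icarr[OF *] .
qed

lemma tr_minus: assumes "x \<in> carrier R" "y \<in> carrier R" shows "t (x \<ominus> y) = t x \<ominus> t y"
proof -
  have "t (x \<ominus> y) \<oplus> t y = t x"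
    using assms tr_add[of "x \<ominus> y" y, symmetric] by (simp add: M.minus_eq M.a_assoc M.l_neg)
  then show ?thesis using assms
    by (metis M.add.inv_solve_right M.minus_closed M.minus_eq tr_closed)
qed

lemma quot_algebra_simps:
  assumes P: "trace_ideal R t P"
  shows "carrier (quot_algebra R P) = (\<lambda>x. P +> x) ` carrier R"
    and "one (quot_algebra R P) = P +> \<one>" and "zero (quot_algebra R P) = P"
    and "\<lbrakk>x \<in> carrier R; y \<in> carrier R\<rbrakk> \<Longrightarrow> (P +> x) \<otimes>\<^bsub>quot_algebra R P\<^esub> (P +> y) = P +> (x \<otimes> y)"
    and "\<lbrakk>x \<in> carrier R; y \<in> carrier R\<rbrakk> \<Longrightarrow> (P +> x) \<oplus>\<^bsub>quot_algebra R P\<^esub> (P +> y) = P +> (x \<oplus> y)"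
    and "\<lbrakk>c \<in> carrier F; x \<in> carrier R\<rbrakk> \<Longrightarrow> c \<odot>\<^bsub>quot_algebra R P\<^esub> (P +> x) = P +> (c \<odot> x)"
    and "x \<in> carrier R \<Longrightarrow> quot_trace R t P (P +> x) = P +> t x"
proof -
  interpret P: ideal P R using trace_idealD(1)[OF P] .
  have eqI: "P +> x = P +> y" if "x \<ominus> y \<in> P" "x \<in> carrier R" "y \<in> carrier R" for x y
    using that M.quotient_eq_iff_same_a_r_cos[OF trace_idealD(1)[OF P]] by blast
  have eqD: "x \<ominus> y \<in> P" "x \<in> carrier R" if "x \<in> P +> y" "y \<in> carrier R" for x y
    using that P.a_rcos_module_minus[OF M.ring_axioms, of y x] P.a_elemrcos_carrier by blast+
  show "carrier (quot_algebra R P) = (\<lambda>x. P +> x) ` carrier R"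
    "one (quot_algebra R P) = P +> \<one>" "zero (quot_algebra R P) = P"
    by (auto simp: quot_algebra_def ring.defs FactRing_def A_RCOSETS_def RCOSETS_def a_r_coset_def)
  show "\<lbrakk>x \<in> carrier R; y \<in> carrier R\<rbrakk> \<Longrightarrow> (P +> x) \<otimes>\<^bsub>quot_algebra R P\<^esub> (P +> y) = P +> (x \<otimes> y)"
    by (simp add: quot_algebra_def ring.defs FactRing_def P.rcoset_mult_add)
  show "\<lbrakk>x \<in> carrier R; y \<in> carrier R\<rbrakk> \<Longrightarrow> (P +> x) \<oplus>\<^bsub>quot_algebra R P\<^esub> (P +> y) = P +> (x \<oplus> y)"
    by (simp add: quot_algebra_def ring.defs FactRing_def P.a_rcos_sum)
  show "quot_trace R t P (P +> x) = P +> t x" if x: "x \<in> carrier R"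
  proof -
    have "P +> t z = P +> t x" if "z \<in> P +> x" for z
      using eqD[OF that x] x trace_idealD(2)[OF P, of "z \<ominus> x"] by (intro eqI) (auto simp: tr_minus)
    then show ?thesis unfolding quot_trace_def using x P.a_rcos_self by blast
  qed
  show "c \<odot>\<^bsub>quot_algebra R P\<^esub> (P +> x) = P +> (c \<odot> x)" if x: "c \<in> carrier F" "x \<in> carrier R"
  proof -
    have "P +> (c \<odot> z) = P +> (c \<odot> x)" if "z \<in> P +> x" for z
    proof (intro eqI)
      have z: "z \<ominus> x \<in> P" "z \<in> carrier R" using eqD[OF that x(2)] .
      have "c \<odot> z \<ominus> c \<odot> x = c \<odot> (z \<ominus> x)"
        using x z by (simp add: M.minus_eq smult_r_distr smult_r_minus)
      also have "\<dots> = (c \<odot> \<one>) \<otimes> (z \<ominus> x)" using x z by (simp add: smult_mult_left)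
      finally show "c \<odot> z \<ominus> c \<odot> x \<in> P" using x z P.I_l_closed by simp
    qed (use eqD[OF that] x in auto)
    moreover have "P +> x \<noteq> {}" using P.a_rcos_self[OF x(2)] by (metis empty_iff)
    ultimately show ?thesis
      by (simp add: quot_algebra_def ring.defs module.defs)
  qed
qed

lemma trace_algebra_quot:
  assumes P: "trace_ideal R t P"
  shows "trace_algebra F (quot_algebra R P) (quot_trace R t P)"
proof -
  interpret P: ideal P R using trace_idealD(1)[OF P] .
  let ?Q = "quot_algebra R P"
  note s = quot_algebra_simps[OF P]
  have ring: "Ring.ring ?Q"
  proof (rule ringI)
    have z: "\<zero>\<^bsub>?Q\<^esub> = P +> \<zero>" by (simp add: s M.a_coset_add_zero P.a_subset)
    show "abelian_group ?Q"
    proof (rule abelian_groupI)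
      fix x assume "x \<in> carrier ?Q"
      then obtain a where a: "a \<in> carrier R" "x = P +> a" by (auto simp: s)
      then have "(P +> (\<ominus> a)) \<oplus>\<^bsub>?Q\<^esub> x = \<zero>\<^bsub>?Q\<^esub>"
        unfolding z by (simp add: s M.l_neg)
      then show "\<exists>y\<in>carrier ?Q. y \<oplus>\<^bsub>?Q\<^esub> x = \<zero>\<^bsub>?Q\<^esub>"
        using a by (auto simp: s(1))
    qed (unfold z, auto simp: s(1,2,4,5) M.a_ac)
    show "Group.monoid ?Q"
      by (rule monoidI) (auto simp: s M.m_assoc)
  qed (auto simp: s M.l_distr M.r_distr)
  interpret Q: Ring.ring ?Q by (rule ring)
  show ?thesis
  proof (intro trace_algebra.intro assoc_algebra.intro Module.module.intro
      trace_algebra_axioms.intro assoc_algebra_axioms.intro Module.module_axioms.intro)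
    fix x y assume "x \<in> carrier ?Q" "y \<in> carrier ?Q"
    then obtain a b where "a \<in> carrier R" "x = P +> a" "b \<in> carrier R" "y = P +> b"
      unfolding s(1) by (elim imageE)
    then show "quot_trace R t P x \<otimes>\<^bsub>?Q\<^esub> y = y \<otimes>\<^bsub>?Q\<^esub> quot_trace R t P x"
      and "quot_trace R t P (x \<otimes>\<^bsub>?Q\<^esub> y) = quot_trace R t P (y \<otimes>\<^bsub>?Q\<^esub> x)"
      by (simp_all add: s tr_central[of a b] tr_commute[of a b])
  qed (use F.field_axioms R.cring_axioms Q.ring_axioms Q.abelian_group_axioms in
      \<open>auto simp: s smult_l_distr smult_r_distr smult_assoc1 smult_mult_left smult_mult_right
          tr_add tr_smult tr_mult_tr\<close>)
qed

lemma closedin_Spec_t: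
  "closedin (Spec_t F R t) C \<longleftrightarrow>
    (\<exists>I. trace_ideal R t I \<and> C = {P. prime_trace_ideal F R t P \<and> I \<subseteq> P})"
  "topspace (Spec_t F R t) = {P. prime_trace_ideal F R t P}"
proof -
  have Inter: "\<Inter>\<F> \<in> {I. trace_ideal R t I}" if "\<F> \<subseteq> {I. trace_ideal R t I}" "\<F> \<noteq> {}" for \<F>
      using M.i_Intersect[of \<F>] that by (fastforce simp: trace_ideal_def)
  have notcarr: "carrier R \<notin> {P. prime_trace_ideal F R t P}"
    proof
      assume "carrier R \<in> {P. prime_trace_ideal F R t P}"
      then have P: "trace_ideal R t (carrier R)" 
        and Q: "prime_trace_algebra F (quot_algebra R (carrier R)) (quot_trace R t (carrier R))"
        by (auto simp: prime_trace_ideal_def)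
      interpret P: ideal "carrier R" R by (rule M.oneideal)
      have "carrier R +> x = carrier R" if "x \<in> carrier R" for x
        using that P.a_rcos_const by blast
      then show False using prime_trace_algebra.nonzero[OF Q] quot_algebra_simps(1,3)[OF P] by auto
    qed
  have prime: "I \<subseteq> P \<or> J \<subseteq> P"
      if "P \<in> {P. prime_trace_ideal F R t P}" and
        *: "I \<in> {I. trace_ideal R t I}" "J \<in> {I. trace_ideal R t I}" "I \<inter> J \<subseteq> P"
      for P I J
    proof -
      from that have P: "trace_ideal R t P" 
        and Q: "prime_trace_algebra F (quot_algebra R P) (quot_trace R t P)"
        by (auto simp: prime_trace_ideal_def)
      interpret P: ideal P R using trace_idealD(1)[OF P] .
      interpret Q: prime_trace_algebra F "quot_algebra R P" "quot_trace R t P" by (rule Q)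
      let ?q = "\<lambda>I. (\<lambda>x. P +> x) ` I"
      have q: "trace_ideal (quot_algebra R P) (quot_trace R t P) (?q I)"
        if "trace_ideal R t I" for I
      proof -
        interpret I: ideal I R using trace_idealD(1)[OF that] .
        have "ideal (?q I) (quot_algebra R P)"
        proof (rule idealI)
          show "subgroup (?q I) (add_monoid (quot_algebra R P))"
          proof (rule Q.M.add.subgroupI)
            show "?q I \<subseteq> carrier (quot_algebra R P)" by (auto simp: quot_algebra_simps[OF P])
            show "?q I \<noteq> {}" using I.zero_closed by blast
            fix a assume "a \<in> ?q I"
            then obtain x where x: "x \<in> I" "a = P +> x" by blast
            have "a \<oplus>\<^bsub>quot_algebra R P\<^esub> (P +> (\<ominus> x)) = \<zero>\<^bsub>quot_algebra R P\<^esub>"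
              using x by (simp add: quot_algebra_simps[OF P] M.r_neg M.a_coset_add_zero P.a_subset)
            then have "\<ominus>\<^bsub>quot_algebra R P\<^esub> a = P +> (\<ominus> x)"
              using x by (intro Q.M.minus_equality[OF _ _ ]) (auto simp: quot_algebra_simps[OF P] M.l_neg M.a_coset_add_zero P.a_subset)
            then show "\<ominus>\<^bsub>quot_algebra R P\<^esub> a \<in> ?q I" using x by auto
          qed (auto simp: quot_algebra_simps[OF P])
        qed (auto simp: quot_algebra_simps[OF P] I.I_l_closed I.I_r_closed Q.M.ring_axioms)
        then show ?thesis using trace_idealD(2)[OF that]
          by (auto simp: trace_ideal_def quot_algebra_simps[OF P])
      qed
      have IJ: "trace_ideal R t I" "trace_ideal R t J" using * by auto
      have "z = P" if "z \<in> ideal_prod (quot_algebra R P) (?q I) (?q J)" for z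
        using that
      proof induction
        case (prod i j)
        then obtain x y where "x \<in> I" "y \<in> J" "i = P +> x" "j = P +> y" by (elim imageE)
        moreover from this have "x \<otimes> y \<in> P"
          using *(3) trace_idealD(3)[OF IJ(1)] trace_idealD(3)[OF IJ(2)]
            ideal.I_r_closed[OF trace_idealD(1)[OF IJ(1)]] ideal.I_l_closed[OF trace_idealD(1)[OF IJ(2)]]
          by (meson IntI subsetD)
        ultimately show ?case
          using trace_idealD(3)[OF IJ(1)] trace_idealD(3)[OF IJ(2)]
          by (simp add: quot_algebra_simps[OF P] P.a_rcos_const)
      next
        case (sum s1 s2)
        then show ?case using Q.M.l_zero[OF Q.M.zero_closed] by (simp add: quot_algebra_simps[OF P])
      qed
      moreover have "P \<in> ideal_prod (quot_algebra R P) (?q I) (?q J)"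
      proof -
        have "\<zero> \<in> I" "\<zero> \<in> J" using trace_idealD(1)[OF IJ(1)] trace_idealD(1)[OF IJ(2)]
          by (auto intro: additive_subgroup.zero_closed ideal.axioms(1))
        then show ?thesis
          using ideal_prod.prod[of "P +> \<zero>" "?q I" "P +> \<zero>" "?q J" "quot_algebra R P"]
            quot_algebra_simps(4)[OF P, of \<zero> \<zero>] M.a_coset_add_zero[OF P.a_subset]
          by (metis M.l_null M.zero_closed imageI)
      qed
      ultimately have "?q I = {P} \<or> ?q J = {P}"
        using Q.prime[OF q[OF IJ(1)] q[OF IJ(2)]] by (auto simp: quot_algebra_simps[OF P])
      moreover have "I \<subseteq> P" if "?q I = {P}" "trace_ideal R t I" for I
      proof
        fix x assume "x \<in> I"
        then have "P +> x = P" "x \<in> carrier R"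
          using that(1) trace_idealD(3)[OF that(2)] by (metis imageI singletonD)+
        then show "x \<in> P" using P.a_rcos_self[of x] by simp
      qed
      ultimately show ?thesis using IJ by metis
    qed
  have carr: "carrier R \<in> {I. trace_ideal R t I}"
    using M.oneideal by (auto simp: trace_ideal_def)
  have sub: "I \<subseteq> carrier R" if "I \<in> {I. trace_ideal R t I}" for I
    using that trace_idealD(3) by blast
  have "{P. prime_trace_ideal F R t P} \<subseteq> {I. trace_ideal R t I}"
    by (auto simp: prime_trace_ideal_def)
  note closedin_zariski_topology[OF carr sub Inter this notcarr prime, folded Spec_t_def]
  then show "closedin (Spec_t F R t) C \<longleftrightarrow>
    (\<exists>I. trace_ideal R t I \<and> C = {P. prime_trace_ideal F R t P \<and> I \<subseteq> P})"
    and "topspace (Spec_t F R t) = {P. prime_trace_ideal F R t P}" by auto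
qed

end

end

(*
  For an ideal p of T one has K(pR) = {x | t(xy) in p for all y}, because t(z) in pR implies
  n t(z) = t(t(z)) in p. This set meets T in p, and R/K(pR) is prime when p is: a nonzero trace
  ideal of the quotient contains the class of a trace that is not in p.

  Conversely, a prime trace ideal P meets T in a prime ideal, since annihilators and multiples of
  traces are trace ideals, and the point is to show K(P) = P. If x is in K(P), all sigma_i(x) with
  i > 0 lie in P, so CH_n gives x^n in P. Hence the trace kernel of R/P is nil of bounded index.
  For u in this kernel with (ux)^(m+1) u = 0 for all x, every w = (ux)^m u satisfies
  (wy)^m w = 0 for all y; induction on m therefore reduces everything to u R u = 0, where the
  annihilator inside the kernel of u and the annihilator of that are trace ideals with zero
  product, both containing u.

  Under the bijection, P contains a trace ideal I iff the prime ideal contains the intersection of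
  I and T, and it contains an ideal of T iff it contains the trace ideal this generates.
*)

theory Submission
  imports Defs "HOL-Algebra.Subrings"
begin

subsection \<open>Nil elements of prime trace algebras\<close>

text \<open>
  Writing \<open>a = u x\<close> and \<open>b = u y a\<^sup>m\<close>, the claim is \<open>a\<^sup>m b\<^sup>m u = 0\<close>. It comes from expanding
  \<open>(a + b)\<^sup>m u\<close>, multiplied on the left by powers of \<open>a\<close>, with \<open>b a c\<^sup>i u = 0\<close> for \<open>c = a + b\<close>.
\<close>

lemma (in ring) pow_sandwich_descent:
  fixes m :: nat
  assumes u: "u \<in> carrier R" and x: "x \<in> carrier R" and y: "y \<in> carrier R" and m: "m > 0"
    and nil: "\<And>z. z \<in> carrier R \<Longrightarrow> (u \<otimes> z) [^] Suc m \<otimes> u = \<zero>"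
  defines "w \<equiv> (u \<otimes> x) [^] m \<otimes> u"
  shows "(w \<otimes> y) [^] m \<otimes> w = \<zero>"
proof -
  obtain k where k: "m = Suc k" using m gr0_implies_Suc by blast
  define a where "a = u \<otimes> x"
  define b where "b = u \<otimes> (y \<otimes> a [^] m)"
  define c where "c = u \<otimes> (x \<oplus> y \<otimes> a [^] m)"
  have a: "a \<in> carrier R" and b: "b \<in> carrier R" and c: "c \<in> carrier R" and w: "w \<in> carrier R"
    using u x y by (simp_all add: a_def b_def c_def w_def)
  have "c = a \<oplus> b" using u x y a by (simp add: c_def b_def a_def r_distr)
  then have c_mult: "c \<otimes> v = a \<otimes> v \<oplus> b \<otimes> v" if "v \<in> carrier R" for v
    using a b that by (simp add: l_distr)
  \<comment> \<open>\<open>c [^] i \<otimes> u\<close> is a right multiple of \<open>u\<close>, and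
    \<open>a [^] Suc m \<otimes> u\<close> is zero by \<open>nil\<close>. So every term that begins
    with \<open>m + 1\<close> factors \<open>a\<close> and goes on with such an element
    vanishes.\<close>
  have c_pow: "\<exists>v\<in>carrier R. c [^] i \<otimes> u = u \<otimes> v" for i :: nat
  proof (cases i)
    case 0
    then show ?thesis using u by (intro bexI[of _ \<one>]) auto
  next
    case (Suc j)
    have "c [^] i \<otimes> u = c \<otimes> (c [^] j \<otimes> u)"
      using Suc c u by (metis m_assoc nat_pow_Suc2 nat_pow_closed)
    also have "\<dots> = u \<otimes> ((x \<oplus> y \<otimes> a [^] m) \<otimes> (c [^] j \<otimes> u))"
      using u x y a c by (simp add: c_def m_assoc)
    finally show ?thesis using u x y a c by blast
  qed
  have a_c: "a [^] Suc m \<otimes> (c [^] i \<otimes> u) = \<zero>" for i :: nat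
  proof -
    obtain v where v: "v \<in> carrier R" "c [^] i \<otimes> u = u \<otimes> v" using c_pow by blast
    have "a [^] Suc m \<otimes> (u \<otimes> v) = (a [^] Suc m \<otimes> u) \<otimes> v"
      using u v a by (simp add: m_assoc del: nat_pow_Suc)
    then show ?thesis using nil[OF x, folded a_def] v by (simp del: nat_pow_Suc)
  qed
  \<comment> \<open>\<open>b\<close> ends in \<open>a [^] m\<close>. In \<open>b \<otimes> c\<close>
    the summand \<open>a\<close> of \<open>c\<close> therefore completes \<open>a [^] Suc m\<close>
    and contributes nothing.\<close>
  have b_c: "b \<otimes> (c [^] i \<otimes> u) = b [^] Suc i \<otimes> u" for i :: nat
  proof (induction i)
    case (Suc i)
    have cu: "c [^] i \<otimes> u \<in> carrier R" using c u by simp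
    have "b \<otimes> (c [^] Suc i \<otimes> u) = b \<otimes> (c \<otimes> (c [^] i \<otimes> u))"
      using c u by (metis m_assoc nat_pow_Suc2 nat_pow_closed)
    also have "\<dots> = b \<otimes> (a \<otimes> (c [^] i \<otimes> u)) \<oplus> b \<otimes> (b \<otimes> (c [^] i \<otimes> u))"
      using a b cu by (simp add: c_mult r_distr)
    also have "b \<otimes> (a \<otimes> (c [^] i \<otimes> u)) = u \<otimes> (y \<otimes> (a [^] Suc m \<otimes> (c [^] i \<otimes> u)))"
      using u y a cu by (simp add: b_def m_assoc)
    also have "\<dots> = \<zero>" unfolding a_c using u y by simp
    also have "b \<otimes> (b \<otimes> (c [^] i \<otimes> u)) = b [^] Suc (Suc i) \<otimes> u"
      unfolding Suc.IH using b u by (metis m_assoc nat_pow_Suc2 nat_pow_closed)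
    finally show ?case using b u by simp
  qed (use b c u in simp)
  have c_Suc: "a [^] j \<otimes> (c [^] Suc i \<otimes> u) =
      a [^] Suc j \<otimes> (c [^] i \<otimes> u) \<oplus> a [^] j \<otimes> (b [^] Suc i \<otimes> u)" for i j :: nat
  proof -
    have cu: "c [^] i \<otimes> u \<in> carrier R" using c u by simp
    have "c [^] Suc i \<otimes> u = c \<otimes> (c [^] i \<otimes> u)"
      using c u by (metis m_assoc nat_pow_Suc2 nat_pow_closed)
    also have "\<dots> = a \<otimes> (c [^] i \<otimes> u) \<oplus> b \<otimes> (c [^] i \<otimes> u)"
      by (rule c_mult[OF cu])
    finally show ?thesis
      unfolding b_c using a b cu u by (simp add: r_distr m_assoc)
  qed
  \<comment> \<open>\<open>a [^] m \<otimes> (c [^] m \<otimes> u)\<close> is evaluated twice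
    through \<open>c_Suc\<close>. As the only summand left in
    \<open>a [^] k \<otimes> (c [^] Suc m \<otimes> u)\<close>, which is zero, it vanishes; expanded
    itself, it equals \<open>a [^] m \<otimes> (b [^] m \<otimes> u)\<close>. Positivity of
    \<open>m\<close> provides the exponent \<open>k = m - 1\<close>.\<close>
  have "a [^] m \<otimes> (b [^] m \<otimes> u) = \<zero>"
  proof -
    have nil_b: "b [^] Suc m \<otimes> u = \<zero>" using nil[of "y \<otimes> a [^] m"] y a by (simp add: b_def)
    have nil_c: "c [^] Suc m \<otimes> u = \<zero>"
      using nil[of "x \<oplus> y \<otimes> a [^] m"] x y a by (simp add: c_def)
    have cl: "a [^] m \<otimes> (c [^] m \<otimes> u) \<in> carrier R" "a [^] m \<otimes> (b [^] m \<otimes> u) \<in> carrier R"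
      using a b c u by simp_all
    have "a [^] m \<otimes> (c [^] m \<otimes> u) = \<zero>"
      using c_Suc[of k m] cl a unfolding nil_b nil_c k[symmetric] by simp
    moreover have "a [^] m \<otimes> (c [^] m \<otimes> u) = a [^] m \<otimes> (b [^] m \<otimes> u)"
      using c_Suc[of m k] cl a unfolding k[symmetric] a_c by simp
    ultimately show ?thesis by simp
  qed
  \<comment> \<open>From \<open>a [^] m \<otimes> b = (w \<otimes> y) \<otimes> a [^] m\<close>,
    pushing \<open>a [^] m\<close> to the right through \<open>b [^] i\<close> produces
    \<open>(w \<otimes> y) [^] i\<close>; there it meets \<open>u\<close> and becomes
    \<open>w\<close>.\<close>
  moreover have "a [^] m \<otimes> (b [^] i \<otimes> u) = (w \<otimes> y) [^] i \<otimes> w" for i :: nat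
  proof (induction i)
    case 0
    show ?case using a u w by (simp add: w_def a_def)
  next
    case (Suc i)
    have "a [^] m \<otimes> (b [^] Suc i \<otimes> u) = a [^] m \<otimes> (b \<otimes> (b [^] i \<otimes> u))"
      using b u by (metis m_assoc nat_pow_Suc2 nat_pow_closed)
    also have "\<dots> = (w \<otimes> y) \<otimes> (a [^] m \<otimes> (b [^] i \<otimes> u))"
    proof -
      have "b [^] i \<otimes> u \<in> carrier R" using b u by simp
      moreover have "b \<otimes> v = u \<otimes> (y \<otimes> (a [^] m \<otimes> v))" if "v \<in> carrier R" for v
        using that u y a by (simp add: b_def m_assoc)
      ultimately show ?thesis using u y a by (simp add: w_def a_def[symmetric] m_assoc)
    qed
    also have "\<dots> = (w \<otimes> y) [^] Suc i \<otimes> w"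
      unfolding Suc.IH using w y by (metis m_assoc m_closed nat_pow_Suc2 nat_pow_closed)
    finally show ?case .
  qed
  ultimately show ?thesis by simp
qed

context trace_algebra
begin

lemma tr_zero [simp]: "t \<zero> = \<zero>"
  using tr_minus[of \<zero> \<zero>] by (simp add: M.minus_eq M.r_neg)

text \<open>Negation is left multiplication by \<open>\<ominus> \<one>\<close>, so closure under it
  comes from absorption.\<close>

lemma trace_idealI:
  assumes "\<zero> \<in> I" and "I \<subseteq> carrier R"
    and "\<And>x y. \<lbrakk>x \<in> I; y \<in> I\<rbrakk> \<Longrightarrow> x \<oplus> y \<in> I"
    and l: "\<And>x y. \<lbrakk>x \<in> I; y \<in> carrier R\<rbrakk> \<Longrightarrow> y \<otimes> x \<in> I"
    and r: "\<And>x y. \<lbrakk>x \<in> I; y \<in> carrier R\<rbrakk> \<Longrightarrow> x \<otimes> y \<in> I"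
    and "\<And>x. x \<in> I \<Longrightarrow> t x \<in> I"
  shows "trace_ideal R t I"
  unfolding trace_ideal_def
proof
  show "ideal I R"
  proof (rule idealI)
    show "subgroup I (add_monoid R)"
    proof (rule M.add.subgroupI)
      fix x assume x: "x \<in> I"
      then have "\<ominus> x = \<ominus> \<one> \<otimes> x" using assms(2) by (auto simp: M.l_minus)
      then show "\<ominus> x \<in> I" using l[OF x] by simp
    qed (use assms in auto)
  qed (use assms M.ring_axioms in auto)
  show "t ` I \<subseteq> I" using assms by auto
qed

end

context prime_trace_algebra
begin

text \<open>Primeness speaks about trace ideals only, but the trace vanishes on \<open>K\<close>, so
  a two-sided ideal inside \<open>K\<close> is automatically one. Here \<open>nil\<close> puts
  \<open>u\<close> into \<open>I\<close>, the definition of \<open>I\<close> then puts it into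
  \<open>J\<close>, and \<open>J\<close> times \<open>I\<close> is zero.\<close>

lemma trace_kernel_semiprime:
  assumes u: "u \<in> carrier R" and tr: "\<And>y. y \<in> carrier R \<Longrightarrow> t (u \<otimes> y) = \<zero>"
    and nil: "\<And>x. x \<in> carrier R \<Longrightarrow> u \<otimes> x \<otimes> u = \<zero>"
  shows "u = \<zero>"
proof -
  define K where "K = {x \<in> carrier R. \<forall>y\<in>carrier R. t (x \<otimes> y) = \<zero>}"
  define I where "I = {x \<in> K. \<forall>r\<in>carrier R. u \<otimes> r \<otimes> x = \<zero>}"
  define J where "J = {y \<in> K. \<forall>x\<in>I. \<forall>r\<in>carrier R. y \<otimes> r \<otimes> x = \<zero>}"
  have K_tr: "t x = \<zero>" if "x \<in> K" for x
  proof -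
    have "t (x \<otimes> \<one>) = \<zero>" "x \<in> carrier R" using that unfolding K_def by blast+
    then show ?thesis by simp
  qed
  have K_carr: "x \<in> carrier R" if "x \<in> K" for x using that by (simp add: K_def)
  have K: "\<zero> \<in> K" "\<lbrakk>x \<in> K; y \<in> K\<rbrakk> \<Longrightarrow> x \<oplus> y \<in> K" "\<lbrakk>x \<in> K; y \<in> carrier R\<rbrakk> \<Longrightarrow> x \<otimes> y \<in> K" for x y
    by (auto simp: K_def M.l_distr tr_add M.m_assoc)
  have K_l: "y \<otimes> x \<in> K" if "x \<in> K" "y \<in> carrier R" for x y
  proof -
    have "t (y \<otimes> x \<otimes> z) = \<zero>" if z: "z \<in> carrier R" for z
    proof -
      have "t (y \<otimes> x \<otimes> z) = t (x \<otimes> (z \<otimes> y))"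
        using tr_commute[of y "x \<otimes> z"] K_carr that z \<open>x \<in> K\<close> \<open>y \<in> carrier R\<close> by (simp add: M.m_assoc)
      then show ?thesis using z \<open>x \<in> K\<close> \<open>y \<in> carrier R\<close> by (simp add: K_def)
    qed
    then show ?thesis using that by (simp add: K_def)
  qed
  have I_K: "x \<in> K" if "x \<in> I" for x using that by (simp add: I_def)
  have J_K: "x \<in> K" if "x \<in> J" for x using that by (simp add: J_def)
  have I: "trace_ideal R t I"
  proof (rule trace_idealI)
    fix x y assume x: "x \<in> I" and y: "y \<in> carrier R"
    have "u \<otimes> r \<otimes> (y \<otimes> x) = \<zero>" if "r \<in> carrier R" for r
    proof -
      have "u \<otimes> r \<otimes> (y \<otimes> x) = u \<otimes> (r \<otimes> y) \<otimes> x"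
        using u that y K_carr[OF I_K[OF x]] by (simp add: M.m_assoc)
      then show ?thesis using x y that by (simp add: I_def)
    qed
    then show "y \<otimes> x \<in> I" using K_l x y by (simp add: I_def)
    have "u \<otimes> r \<otimes> (x \<otimes> y) = \<zero>" if "r \<in> carrier R" for r
    proof -
      have "u \<otimes> r \<otimes> (x \<otimes> y) = (u \<otimes> r \<otimes> x) \<otimes> y"
        using u that y K_carr[OF I_K[OF x]] by (simp add: M.m_assoc)
      then show ?thesis using x y that by (simp add: I_def)
    qed
    then show "x \<otimes> y \<in> I" using K x y by (simp add: I_def)
  qed (use u K K_tr K_carr in \<open>auto simp: I_def M.r_distr\<close>)
  have J: "trace_ideal R t J"
  proof (rule trace_idealI)
    fix x y assume x: "x \<in> J" and y: "y \<in> carrier R"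
    have xc: "x \<in> carrier R" using K_carr[OF J_K[OF x]] .
    have "y \<otimes> x \<otimes> r \<otimes> z = \<zero>" "x \<otimes> y \<otimes> r \<otimes> z = \<zero>" if "r \<in> carrier R" "z \<in> I" for r z
    proof -
      have z: "z \<in> carrier R" using K_carr[OF I_K[OF that(2)]] .
      have "y \<otimes> x \<otimes> r \<otimes> z = y \<otimes> (x \<otimes> r \<otimes> z)" "x \<otimes> y \<otimes> r \<otimes> z = x \<otimes> (y \<otimes> r) \<otimes> z"
        using xc that y z by (simp_all add: M.m_assoc)
      then show "y \<otimes> x \<otimes> r \<otimes> z = \<zero>" "x \<otimes> y \<otimes> r \<otimes> z = \<zero>" using x y that by (simp_all add: J_def)
    qed
    then show "y \<otimes> x \<in> J" "x \<otimes> y \<in> J" using K K_l x y by (simp_all add: J_def)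
  qed (use K K_tr K_carr I_K in \<open>auto simp: J_def M.l_distr\<close>)
  have uK: "u \<in> K" using u tr by (simp add: K_def)
  then have uIJ: "u \<in> I" "u \<in> J" using u nil by (auto simp: I_def J_def)
  have JI: "y \<otimes> x = \<zero>" if "y \<in> J" "x \<in> I" for x y
  proof -
    have "y \<otimes> \<one> \<otimes> x = \<zero>" using that unfolding J_def by blast
    then show ?thesis using K_carr[OF J_K[OF that(1)]] by simp
  qed
  have "z = \<zero>" if "z \<in> ideal_prod R J I" for z
    using that by induction (use JI in auto)
  moreover have "\<zero> \<in> ideal_prod R J I"
    using ideal_prod.prod[of u J u I R] uIJ JI by metis
  ultimately have "ideal_prod R J I = {\<zero>}" by blast
  then show ?thesis using prime[OF J I] uIJ by blast
qed

text \<open>The induction hypothesis is used twice. By the descent, each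
  \<open>(u \<otimes> x) [^] m \<otimes> u\<close> meets the assumptions with exponent
  \<open>m\<close>, so it is zero; but this says that \<open>u\<close> itself meets them with
  exponent \<open>m\<close>.\<close>

lemma trace_kernel_nil_eq_zero:
  fixes m :: nat
  assumes "u \<in> carrier R" and "\<And>y. y \<in> carrier R \<Longrightarrow> t (u \<otimes> y) = \<zero>"
    and "\<And>x. x \<in> carrier R \<Longrightarrow> (u \<otimes> x) [^] m \<otimes> u = \<zero>"
  shows "u = \<zero>"
  using assms
proof (induction m arbitrary: u)
  case 0
  show ?case using "0.prems"(1) "0.prems"(3)[OF M.one_closed] by simp
next
  case (Suc m)
  note u = Suc.prems(1)
  \<comment> \<open>For \<open>m = 0\<close> the assumption reads
    \<open>u \<otimes> x \<otimes> u = \<zero>\<close>, and the semiprime case applies; the descent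
    works with positive exponents.\<close>
  show ?case
  proof (cases "m = 0")
    case True
    have "u \<otimes> x \<otimes> u = \<zero>" if "x \<in> carrier R" for x
      using Suc.prems(3)[OF that] True u that by simp
    then show ?thesis using trace_kernel_semiprime[OF Suc.prems(1,2)] by blast
  next
    case False
    have "(u \<otimes> x) [^] m \<otimes> u = \<zero>" if x: "x \<in> carrier R" for x
    proof (rule Suc.IH)
      let ?w = "(u \<otimes> x) [^] m \<otimes> u"
      show "?w \<in> carrier R" using u x by simp
      show "t (?w \<otimes> y) = \<zero>" if y: "y \<in> carrier R" for y
      proof -
        have "t (?w \<otimes> y) = t (u \<otimes> (y \<otimes> (u \<otimes> x) [^] m))"
          using tr_commute[of "(u \<otimes> x) [^] m" "u \<otimes> y"] u x y by (simp add: M.m_assoc)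
        then show ?thesis using Suc.prems(2) u x y by simp
      qed
      show "(?w \<otimes> y) [^] m \<otimes> ?w = \<zero>" if y: "y \<in> carrier R" for y
        using M.pow_sandwich_descent[OF u x y _ Suc.prems(3)] False by blast
    qed
    then show ?thesis using Suc.IH[OF Suc.prems(1,2)] by blast
  qed
qed

end

subsection \<open>The trace ring\<close>

lemma trace_ring_simps [simp]:
  "carrier (trace_ring R t) = t ` carrier R"
  "x \<otimes>\<^bsub>trace_ring R t\<^esub> y = x \<otimes>\<^bsub>R\<^esub> y" "x \<oplus>\<^bsub>trace_ring R t\<^esub> y = x \<oplus>\<^bsub>R\<^esub> y"
  "\<one>\<^bsub>trace_ring R t\<^esub> = \<one>\<^bsub>R\<^esub>" "\<zero>\<^bsub>trace_ring R t\<^esub> = \<zero>\<^bsub>R\<^esub>"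
  by (simp_all add: trace_ring_def)

context trace_algebra
begin

text \<open>Right absorption is associativity, left absorption is cyclicity of the trace.
  \<open>I\<close> is an arbitrary set, so that ideals of \<open>R\<close> and ideals of the trace
  ring are both covered.\<close>

lemma radical_kernel_absorb:
  assumes "x \<in> radical_kernel R t I" and y: "y \<in> carrier R"
  shows "x \<otimes> y \<in> radical_kernel R t I" and "y \<otimes> x \<in> radical_kernel R t I"
proof -
  have x: "x \<in> carrier R" "\<And>z. z \<in> carrier R \<Longrightarrow> t (x \<otimes> z) \<in> I"
    using assms by (auto simp: radical_kernel_def)
  show "x \<otimes> y \<in> radical_kernel R t I"
    using x y by (simp add: radical_kernel_def M.m_assoc)
  have "t (y \<otimes> x \<otimes> z) = t (x \<otimes> (z \<otimes> y))" if "z \<in> carrier R" for z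
    using tr_commute[of y "x \<otimes> z"] x y that by (simp add: M.m_assoc)
  then show "y \<otimes> x \<in> radical_kernel R t I"
    using x y by (simp add: radical_kernel_def)
qed

lemma smult_mem_ideal:
  assumes "ideal I R" and "c \<in> carrier F" and "x \<in> I"
  shows "c \<odot> x \<in> I"
proof -
  have x: "x \<in> carrier R" using ideal.Icarr assms by metis
  have "c \<odot> x = (c \<odot> \<one>) \<otimes> x" using x assms by (simp add: smult_mult_left)
  then show ?thesis using ideal.I_l_closed[OF assms(1,3), of "c \<odot> \<one>"] assms(2) by simp
qed

lemma finsum_mem_ideal:
  assumes I: "ideal I R" and "finite A" and "\<And>i. i \<in> A \<Longrightarrow> f i \<in> I"
  shows "(\<Oplus>i\<in>A. f i) \<in> I"
  using assms(2,3)
proof (induction A)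
  case empty
  show ?case using additive_subgroup.zero_closed[OF ideal.axioms(1)[OF I]] by simp
next
  case (insert a A)
  then have "f \<in> A \<rightarrow> carrier R" "f a \<in> carrier R" using ideal.Icarr[OF I] by auto
  then show ?case using insert additive_subgroup.a_closed[OF ideal.axioms(1)[OF I]] by simp
qed

lemma ps_power_closed:
  assumes "\<And>j. f j \<in> carrier R"
  shows "ps_power R f m k \<in> carrier R"
  using assms by (induction m arbitrary: k) (auto simp: ps_mult_def intro!: M.finsum_closed)

text \<open>A positive power has a factor \<open>f\<close> in front, so every summand of the
  convolution has a factor in \<open>I\<close>. The power with \<open>m = 0\<close> is the series
  1.\<close>

lemma ps_power_mem_ideal:
  assumes I: "ideal I R" and f: "\<And>j. f j \<in> I" and "m > 0"
  shows "ps_power R f m k \<in> I"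
proof -
  obtain l where l: "m = Suc l" using assms(3) gr0_implies_Suc by blast
  have "ps_power R f l i \<in> carrier R" for i
    using ideal.Icarr[OF I f] by (rule ps_power_closed)
  then show ?thesis
    unfolding l ps_power.simps ps_mult_def
    by (intro finsum_mem_ideal[OF I] ideal.I_r_closed[OF I f]) auto
qed

lemma pow_quot_algebra:
  assumes P: "trace_ideal R t P" and x: "x \<in> carrier R"
  shows "(P +> x) [^]\<^bsub>quot_algebra R P\<^esub> (k :: nat) = P +> (x [^] k)"
proof -
  interpret Q: trace_algebra F "quot_algebra R P" "quot_trace R t P"
    by (rule trace_algebra_quot[OF P])
  show ?thesis
    by (induction k) (simp_all add: quot_algebra_simps[OF P] x)
qed

lemma coset_eq_iff:
  assumes "trace_ideal R t P" and "x \<in> carrier R"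
  shows "P +> x = P \<longleftrightarrow> x \<in> P"
proof -
  interpret ideal P R using trace_idealD(1)[OF assms(1)] .
  show ?thesis using a_rcos_self[OF assms(2)] a_rcos_const by blast
qed

lemma tr_image_absorb:
  assumes "z \<in> t ` carrier R" and "x \<in> carrier R"
  shows "z \<in> carrier R" "z \<otimes> x = x \<otimes> z" "t (z \<otimes> x) = z \<otimes> t x" "z \<otimes> t x \<in> t ` carrier R"
proof -
  obtain y where y: "y \<in> carrier R" "z = t y" using assms(1) by blast
  show z: "z \<in> carrier R" "z \<otimes> x = x \<otimes> z" "t (z \<otimes> x) = z \<otimes> t x"
    unfolding y(2)
    by (rule tr_closed[OF y(1)] tr_central[OF y(1) assms(2)] tr_mult_tr[OF y(1) assms(2)])+
  show "z \<otimes> t x \<in> t ` carrier R"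
    unfolding z(3)[symmetric] by (rule imageI) (rule M.m_closed[OF z(1) assms(2)])
qed

end

section \<open>Traces in a prime trace algebra\<close>

context prime_trace_algebra
begin

text \<open>The multiples \<open>J\<close> of \<open>a\<close> and its annihilator \<open>I\<close>
  are ideals because \<open>a\<close> is central, and trace ideals because
  \<open>t (a \<otimes> x) = a \<otimes> t x\<close>. Their product is zero, with \<open>a\<close>
  in \<open>J\<close> and \<open>b\<close> in \<open>I\<close>.\<close>

lemma tr_image_no_zero_divisors:
  assumes a: "a \<in> t ` carrier R" and b: "b \<in> t ` carrier R" and ab: "a \<otimes> b = \<zero>"
  shows "a = \<zero> \<or> b = \<zero>"
proof -
  note a' = tr_image_absorb[OF a] and b' = tr_image_absorb(1)[OF b]
  have ac: "a \<in> carrier R" and bc: "b \<in> carrier R" using a'(1) b' M.zero_closed by blast+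
  define I where "I = {x \<in> carrier R. a \<otimes> x = \<zero>}"
  define J where "J = (\<lambda>r. a \<otimes> r) ` carrier R"
  have I: "trace_ideal R t I"
  proof (rule trace_idealI)
    fix x y assume x: "x \<in> I" and y: "y \<in> carrier R"
    then have xc: "x \<in> carrier R" "a \<otimes> x = \<zero>" by (simp_all add: I_def)
    have "a \<otimes> (y \<otimes> x) = y \<otimes> (a \<otimes> x)" "a \<otimes> (x \<otimes> y) = (a \<otimes> x) \<otimes> y"
      using a'(2)[OF y] ac xc(1) y by (simp_all add: M.m_assoc[symmetric])
    then show "y \<otimes> x \<in> I" "x \<otimes> y \<in> I" using xc y by (simp_all add: I_def)
  next
    fix x assume "x \<in> I"
    then show "t x \<in> I" using a'(3)[of x] by (simp add: I_def)
  qed (auto simp: I_def ac M.r_distr)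
  have J: "trace_ideal R t J"
  proof (rule trace_idealI)
    show "\<zero> \<in> J" unfolding J_def using ac by (intro image_eqI[of _ _ \<zero>]) simp_all
    fix x assume "x \<in> J"
    then obtain r where r: "r \<in> carrier R" "x = a \<otimes> r" by (auto simp: J_def)
    show "t x \<in> J" using a'(3)[OF r(1)] r by (auto simp: J_def)
    fix y
    show "x \<oplus> y \<in> J" if yJ: "y \<in> J"
    proof -
      obtain s where s: "s \<in> carrier R" "y = a \<otimes> s" using yJ by (auto simp: J_def)
      have "x \<oplus> y = a \<otimes> (r \<oplus> s)" using ac r s by (simp add: M.r_distr)
      then show ?thesis using r s by (simp add: J_def)
    qed
    assume y: "y \<in> carrier R"
    have "x \<otimes> y = a \<otimes> (r \<otimes> y)" using ac r y by (simp add: M.m_assoc)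
    then show "x \<otimes> y \<in> J" using r y by (simp add: J_def)
    have "y \<otimes> x = (a \<otimes> y) \<otimes> r" unfolding a'(2)[OF y] using ac r y by (simp add: M.m_assoc)
    then have "y \<otimes> x = a \<otimes> (y \<otimes> r)" using ac r y by (simp add: M.m_assoc)
    then show "y \<otimes> x \<in> J" using r y by (simp add: J_def)
  qed (use ac in \<open>auto simp: J_def\<close>)
  have mem: "a \<in> J" "b \<in> I"
    unfolding I_def J_def using ac bc ab by (auto intro: image_eqI[of _ _ \<one>])
  have JI: "y \<otimes> x = \<zero>" if yx: "y \<in> J" "x \<in> I" for x y
  proof -
    obtain r where r: "r \<in> carrier R" "y = a \<otimes> r" using yx(1) by (auto simp: J_def)
    have x: "x \<in> carrier R" "a \<otimes> x = \<zero>" using yx(2) by (simp_all add: I_def)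
    have "y \<otimes> x = r \<otimes> (a \<otimes> x)" unfolding r(2) a'(2)[OF r(1)] using ac r x by (simp add: M.m_assoc)
    then show ?thesis using r x by simp
  qed
  have "z = \<zero>" if "z \<in> ideal_prod R J I" for z
    using that by induction (use JI in auto)
  moreover have "\<zero> \<in> ideal_prod R J I"
    using ideal_prod.prod[of a J b I R] mem ab by simp
  ultimately have "ideal_prod R J I = {\<zero>}" by blast
  then show ?thesis using prime[OF J I] mem by blast
qed

end

section \<open>Consequences of the Cayley-Hamilton identity\<close>

context cayley_hamilton_algebra
begin

lemma nat_mult_one_Units: "m > 0 \<Longrightarrow> [(m::nat)] \<cdot>\<^bsub>F\<^esub> \<one>\<^bsub>F\<^esub> \<in> Units F"
  unfolding F.field_Units using char_zero[of m] by auto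

lemma inv_of_nat_closed: "m > 0 \<Longrightarrow> inv_of_nat F m \<in> carrier F"
  unfolding inv_of_nat_def by (rule R.Units_inv_closed[OF nat_mult_one_Units])

text \<open>All \<open>t (x [^] j)\<close> with \<open>j > 0\<close> lie in \<open>P\<close>, hence
  so do the coefficients of the series \<open>f\<close> inside the exponential. Only its zeroth
  power could leave \<open>P\<close>, and this contributes in degree 0 alone.\<close>

lemma sigma_mem_ideal:
  assumes P: "ideal P R" and x: "x \<in> radical_kernel R t P" and i: "i > 0"
  shows "sigma F R t i x \<in> P"
proof -
  define f where "f = (\<lambda>j. if j = 0 then \<zero> else \<ominus> (inv_of_nat F j \<odot> t (x [^] j)))"
  have xc: "x \<in> carrier R" using x by (simp add: radical_kernel_def)
  have f: "f j \<in> P" for j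
  proof (cases j)
    case 0
    then show ?thesis
      using additive_subgroup.zero_closed[OF ideal.axioms(1)[OF P]] by (simp add: f_def)
  next
    case (Suc k)
    have "t (x [^] j) = t (x \<otimes> x [^] k)" using M.nat_pow_Suc2[OF xc] Suc by simp
    then have "t (x [^] j) \<in> P" using x xc by (simp add: radical_kernel_def)
    then show ?thesis using Suc inv_of_nat_closed[of j] smult_mem_ideal[OF P]
      additive_subgroup.a_inv_closed[OF ideal.axioms(1)[OF P]] by (simp add: f_def)
  qed
  have "ps_power R f m i \<in> P" for m
  proof (cases m)
    case 0
    then show ?thesis using i additive_subgroup.zero_closed[OF ideal.axioms(1)[OF P]] by simp
  next
    case (Suc l)
    then show ?thesis by (intro ps_power_mem_ideal[OF P f]) simp
  qed
  then have "ps_exp F R f i \<in> P"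
    unfolding ps_exp_def
    by (intro finsum_mem_ideal[OF P] smult_mem_ideal[OF P] inv_of_nat_closed) auto
  then show ?thesis
    unfolding sigma_def f_def by (intro ideal.I_l_closed[OF P]) auto
qed

text \<open>Every term of \<open>CH\<close> after the leading one has a factor
  \<open>sigma F R t i x\<close> with \<open>i > 0\<close>.\<close>

lemma pow_mem_of_radical_kernel:
  assumes P: "ideal P R" and x: "x \<in> radical_kernel R t P"
  shows "x [^] n \<in> P"
proof -
  have xc: "x \<in> carrier R" using x by (simp add: radical_kernel_def)
  let ?s = "\<Oplus>i\<in>{1..n}. (\<ominus> \<one>) [^] i \<otimes> sigma F R t i x \<otimes> x [^] (n - i)"
  have s: "?s \<in> P"
    using xc by (intro finsum_mem_ideal[OF P] ideal.I_r_closed[OF P] ideal.I_l_closed[OF P]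
        sigma_mem_ideal[OF P x]) auto
  have "x [^] n \<oplus> ?s = \<zero>" using CH_zero[OF xc] by (simp add: CH_def)
  then have "x [^] n = \<ominus> ?s" using ideal.Icarr[OF P s] xc M.minus_equality by fastforce
  then show ?thesis using s additive_subgroup.a_inv_closed[OF ideal.axioms(1)[OF P]] by simp
qed

text \<open>The class of \<open>x\<close> lies in the trace kernel of the quotient. Since the
  radical kernel absorbs products, \<open>(x \<otimes> r) [^] n\<close> is in \<open>P\<close> for
  all \<open>r\<close> with the same exponent \<open>n\<close>; this uniform bound is what
  \<open>trace_kernel_nil_eq_zero\<close> asks for.\<close>

lemma radical_kernel_prime_trace_ideal:
  assumes "prime_trace_ideal F R t P" and x: "x \<in> radical_kernel R t P"
  shows "x \<in> P"
proof -
  let ?Q = "quot_algebra R P"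
  have P: "trace_ideal R t P" using assms by (simp add: prime_trace_ideal_def)
  interpret Q: prime_trace_algebra F ?Q "quot_trace R t P"
    using assms by (simp add: prime_trace_ideal_def)
  note s = quot_algebra_simps[OF P] and I = trace_idealD(1)[OF P]
  have xc: "x \<in> carrier R" using x by (simp add: radical_kernel_def)
  have "P +> x = \<zero>\<^bsub>?Q\<^esub>"
  proof (rule Q.trace_kernel_nil_eq_zero)
    show "P +> x \<in> carrier ?Q" using xc by (simp add: s)
  next
    fix y assume "y \<in> carrier ?Q"
    then obtain r where r: "r \<in> carrier R" "y = P +> r" by (auto simp: s)
    have xr: "x \<otimes> r \<in> radical_kernel R t P" using radical_kernel_absorb(1)[OF x r(1)] .
    show "quot_trace R t P ((P +> x) \<otimes>\<^bsub>?Q\<^esub> y) = \<zero>\<^bsub>?Q\<^esub>"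
      using x xc r by (simp add: s coset_eq_iff[OF P] radical_kernel_def)
    show "((P +> x) \<otimes>\<^bsub>?Q\<^esub> y) [^]\<^bsub>?Q\<^esub> n \<otimes>\<^bsub>?Q\<^esub> (P +> x) = \<zero>\<^bsub>?Q\<^esub>"
      using xc r ideal.I_r_closed[OF I pow_mem_of_radical_kernel[OF I xr] xc]
      by (simp add: s coset_eq_iff[OF P] pow_quot_algebra[OF P])
  qed
  then show ?thesis using coset_eq_iff[OF P xc] by (simp add: s)
qed

text \<open>Turns the integer \<open>t \<one>\<close> into a scalar, which can be inverted in
  \<open>F\<close>.\<close>

lemma nat_mult_one: "[(k::nat)] \<cdot> \<one> = ([k] \<cdot>\<^bsub>F\<^esub> \<one>\<^bsub>F\<^esub>) \<odot> \<one>"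
  by (induction k) (simp_all add: smult_l_distr)

text \<open>The element \<open>1/n\<close> serves as \<open>e\<close>; if \<open>n = 0\<close> then \<open>CH\<close> at \<open>\<one>\<close> gives \<open>\<one> = \<zero>\<close>.\<close>

lemma tr_image_unit:
  shows "\<exists>e\<in>t ` carrier R. \<forall>z\<in>t ` carrier R. e \<otimes> t z = z"
    and one_mem_tr_image: "\<one> \<in> t ` carrier R"
proof -
  have "\<exists>c\<in>carrier F. c \<odot> t \<one> = \<one>"
  proof (cases "n = 0")
    case True
    have "\<one> = \<zero>" using CH_zero[OF M.one_closed] True by (simp add: CH_def)
    then have "\<one>\<^bsub>F\<^esub> \<odot> t \<one> = \<one>" by simp
    then show ?thesis by blast
  next
    case False
    let ?m = "[n] \<cdot>\<^bsub>F\<^esub> \<one>\<^bsub>F\<^esub>"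
    have u: "?m \<in> Units F" using nat_mult_one_Units False by simp
    have "inv\<^bsub>F\<^esub> ?m \<odot> t \<one> = (inv\<^bsub>F\<^esub> ?m \<otimes>\<^bsub>F\<^esub> ?m) \<odot> \<one>"
      unfolding tr_one nat_mult_one
      by (rule smult_assoc1[symmetric, OF R.Units_inv_closed[OF u] R.Units_closed[OF u] M.one_closed])
    then show ?thesis using u R.Units_inv_closed by (auto simp: R.Units_l_inv)
  qed
  then obtain c where c: "c \<in> carrier F" "c \<odot> t \<one> = \<one>" by blast
  have "t (c \<odot> \<one>) = \<one>" using c by (simp add: tr_smult)
  then show "\<one> \<in> t ` carrier R" using c by (metis imageI M.one_closed smult_closed)
  show "\<exists>e\<in>t ` carrier R. \<forall>z\<in>t ` carrier R. e \<otimes> t z = z"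
  proof (intro bexI[of _ "c \<odot> \<one>"] ballI)
    \<comment> \<open>The scalar \<open>c\<close> inverts \<open>t \<one>\<close>, so one of the two
      factors \<open>c\<close> is cancelled by the trace.\<close>
    have "t (c \<odot> (c \<odot> \<one>)) = c \<odot> \<one>" using c by (simp add: tr_smult)
    then show "c \<odot> \<one> \<in> t ` carrier R" using c by (metis imageI M.one_closed smult_closed)
    fix z assume z: "z \<in> t ` carrier R"
    then have zc: "z \<in> carrier R" by auto
    have "t z = z \<otimes> t \<one>" using tr_image_absorb(3)[OF z M.one_closed] zc by simp
    then have "(c \<odot> \<one>) \<otimes> t z = z \<otimes> (c \<odot> t \<one>)"
      using c zc by (simp add: smult_mult_left smult_mult_right[symmetric])
    then show "(c \<odot> \<one>) \<otimes> t z = z" using c zc by simp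
  qed
qed

section \<open>Contraction and radical kernels between trace ring and algebra\<close>

lemma cring_trace_ring: "cring (trace_ring R t)"
proof -
  have "subcring (t ` carrier R) R"
  proof (intro M.subcringI M.subringI one_mem_tr_image)
    fix h assume "h \<in> t ` carrier R"
    then obtain a where a: "a \<in> carrier R" "h = t a" by blast
    have "t (\<ominus> a) = \<ominus> h" using tr_minus[of \<zero> a] a by (simp add: M.minus_eq)
    then show "\<ominus> h \<in> t ` carrier R" using a by (metis imageI M.a_inv_closed)
  next
    fix h k assume h: "h \<in> t ` carrier R" and "k \<in> t ` carrier R"
    then obtain a b where ab: "a \<in> carrier R" "h = t a" "b \<in> carrier R" "k = t b" by blast
    show "h \<otimes> k \<in> t ` carrier R" using tr_image_absorb(4)[OF h ab(3)] ab by simp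
    show "h \<otimes> k = k \<otimes> h" using tr_image_absorb(2)[OF h] ab by simp
    have "t (a \<oplus> b) = h \<oplus> k" using ab tr_add by simp
    then show "h \<oplus> k \<in> t ` carrier R" using ab by (metis imageI M.a_closed)
  qed auto
  moreover have "t ` carrier R \<subseteq> carrier R" by auto
  ultimately show ?thesis using M.subcring_iff by (simp add: trace_ring_def)
qed

text \<open>The last rule carries the content: on traces \<open>t\<close> is multiplication by
  \<open>t \<one>\<close>, and \<open>tr_image_unit\<close> supplies \<open>e\<close> in the trace
  ring with \<open>e \<otimes> t x = x\<close>.\<close>

lemma ideal_trace_ringD:
  assumes "ideal I (trace_ring R t)"
  shows "\<zero> \<in> I" "x \<in> I \<Longrightarrow> x \<in> t ` carrier R" "x \<in> I \<Longrightarrow> x \<in> carrier R"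
    and "\<lbrakk>x \<in> I; y \<in> I\<rbrakk> \<Longrightarrow> x \<oplus> y \<in> I"
    and "\<lbrakk>x \<in> I; y \<in> carrier R\<rbrakk> \<Longrightarrow> x \<otimes> t y \<in> I"
    and "\<lbrakk>x \<in> t ` carrier R; t x \<in> I\<rbrakk> \<Longrightarrow> x \<in> I"
proof -
  interpret I: ideal I "trace_ring R t" by (rule assms)
  show "\<zero> \<in> I" "x \<in> I \<Longrightarrow> x \<in> t ` carrier R"
    "\<lbrakk>x \<in> I; y \<in> I\<rbrakk> \<Longrightarrow> x \<oplus> y \<in> I" "\<lbrakk>x \<in> I; y \<in> carrier R\<rbrakk> \<Longrightarrow> x \<otimes> t y \<in> I"
    using additive_subgroup.zero_closed[OF I.additive_subgroup_axioms] I.Icarr[of x]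
      additive_subgroup.a_closed[OF I.additive_subgroup_axioms, of x y]
      I.I_r_closed[of x "t y"] by simp_all
  then show "x \<in> I \<Longrightarrow> x \<in> carrier R" by auto
  show "x \<in> I" if x: "x \<in> t ` carrier R" "t x \<in> I"
  proof -
    obtain e where e: "e \<in> t ` carrier R" and *: "\<forall>z\<in>t ` carrier R. e \<otimes> t z = z"
      using tr_image_unit(1) by (rule bexE)
    have "e \<otimes>\<^bsub>trace_ring R t\<^esub> t x \<in> I"
      by (rule I.I_l_closed[OF x(2)]) (unfold trace_ring_simps, rule e)
    then show ?thesis unfolding trace_ring_simps bspec[OF * x(1)] .
  qed
qed

text \<open>Allows all further arguments to use \<open>I\<close> in place of the ideal it generates.
  The trace maps that ideal into \<open>I\<close>, by
  \<open>t (i \<otimes> j) = i \<otimes> t j\<close>; if it contains \<open>t x\<close>, then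
  \<open>t (t x)\<close> is in \<open>I\<close>, and hence \<open>t x\<close> is.\<close>

lemma radical_kernel_ideal_prod:
  assumes I: "ideal I (trace_ring R t)"
  shows "radical_kernel R t (ideal_prod R I (carrier R)) = radical_kernel R t I"
proof -
  note D = ideal_trace_ringD[OF I]
  have *: "t z \<in> I \<and> z \<in> carrier R" if "z \<in> ideal_prod R I (carrier R)" for z
    using that
  proof induction
    case (prod i j)
    then show ?case using tr_image_absorb(3)[OF D(2)] D(3,5) by simp
  next
    case (sum x y)
    then show ?case using D(4) by (simp add: tr_add)
  qed
  have "t x \<in> ideal_prod R I (carrier R) \<longleftrightarrow> t x \<in> I" if "x \<in> carrier R" for x
  proof
    assume "t x \<in> ideal_prod R I (carrier R)"
    then show "t x \<in> I" using * D(6) that by blast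
  next
    assume "t x \<in> I"
    then show "t x \<in> ideal_prod R I (carrier R)"
      using ideal_prod.prod[of "t x" I \<one> "carrier R" R] that by simp
  qed
  then show ?thesis by (auto simp: radical_kernel_def)
qed

text \<open>One inclusion tests a trace \<open>x\<close> against \<open>\<one>\<close>, which gives
  \<open>t x\<close> in \<open>I\<close> and so \<open>x\<close> in \<open>I\<close>; the other is
  \<open>t (x \<otimes> y) = x \<otimes> t y\<close>.\<close>

lemma radical_kernel_Int_tr_image:
  assumes I: "ideal I (trace_ring R t)"
  shows "radical_kernel R t I \<inter> t ` carrier R = I"
proof (intro equalityI subsetI)
  note D = ideal_trace_ringD[OF I]
  fix x assume x: "x \<in> radical_kernel R t I \<inter> t ` carrier R"
  then have "t (x \<otimes> \<one>) \<in> I" "x \<in> carrier R" unfolding radical_kernel_def by blast+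
  then show "x \<in> I" using x D(6) by simp
next
  note D = ideal_trace_ringD[OF I]
  fix x assume x: "x \<in> I"
  then show "x \<in> radical_kernel R t I \<inter> t ` carrier R"
    using D(2,3,5)[OF x] tr_image_absorb(3)[OF D(2)[OF x]] by (simp add: radical_kernel_def)
qed

lemma trace_ideal_radical_kernel:
  assumes I: "ideal I (trace_ring R t)"
  shows "trace_ideal R t (radical_kernel R t I)"
proof (rule trace_idealI)
  note D = ideal_trace_ringD[OF I]
  fix x assume x: "x \<in> radical_kernel R t I"
  then have "t (x \<otimes> \<one>) \<in> I" "x \<in> carrier R" unfolding radical_kernel_def by blast+
  then have "t x \<in> I" "x \<in> carrier R" by simp_all
  then show "t x \<in> radical_kernel R t I"
    using D(5) by (simp add: radical_kernel_def tr_mult_tr)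
next
  fix x y assume "x \<in> radical_kernel R t I" "y \<in> radical_kernel R t I"
  then show "x \<oplus> y \<in> radical_kernel R t I"
    using ideal_trace_ringD(4)[OF I] by (simp add: radical_kernel_def M.l_distr tr_add)
next
  show "\<zero> \<in> radical_kernel R t I"
    using ideal_trace_ringD(1)[OF I] by (simp add: radical_kernel_def)
  show "radical_kernel R t I \<subseteq> carrier R" unfolding radical_kernel_def by blast
qed (erule (1) radical_kernel_absorb)+

text \<open>Two nonzero trace ideals of the quotient contain classes of traces \<open>t a\<close>
  and \<open>t b\<close> outside \<open>I\<close>. If their product were zero,
  \<open>t a \<otimes> t b\<close> would lie in \<open>?K\<close> and in the trace ring, hence in
  \<open>I\<close>.\<close>

lemma prime_trace_ideal_radical_kernel:
  assumes "primeideal I (trace_ring R t)"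
  shows "prime_trace_ideal F R t (radical_kernel R t I)"
proof -
  interpret I: primeideal I "trace_ring R t" by (rule assms)
  let ?K = "radical_kernel R t I"
  let ?Q = "quot_algebra R ?K" and ?t = "quot_trace R t ?K"
  have K: "trace_ideal R t ?K" by (rule trace_ideal_radical_kernel[OF I.is_ideal])
  note s = quot_algebra_simps[OF K] and Int = radical_kernel_Int_tr_image[OF I.is_ideal]
  interpret Q: trace_algebra F ?Q ?t by (rule trace_algebra_quot[OF K])
  \<comment> \<open>A representative \<open>x\<close> outside \<open>?K\<close> has, by definition
    of the radical kernel, some \<open>r\<close> with \<open>t (x \<otimes> r)\<close> outside
    \<open>I\<close>; the class of this trace stays in \<open>X\<close>.\<close>
  have tr_nonzero: "\<exists>a\<in>carrier R. ?K +> t a \<in> X \<and> t a \<notin> I"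
    if X: "trace_ideal ?Q ?t X" "X \<noteq> {\<zero>\<^bsub>?Q\<^esub>}" for X
  proof -
    interpret X: ideal X ?Q using Q.trace_idealD(1)[OF X(1)] .
    obtain y where y: "y \<in> X" "y \<noteq> \<zero>\<^bsub>?Q\<^esub>"
      using X(2) additive_subgroup.zero_closed[OF X.additive_subgroup_axioms] by blast
    then obtain x where x: "x \<in> carrier R" "y = ?K +> x" using X.Icarr[OF y(1)] by (auto simp: s)
    then have "x \<notin> ?K" using y(2) coset_eq_iff[OF K x(1)] by (simp add: s)
    then obtain r where r: "r \<in> carrier R" "t (x \<otimes> r) \<notin> I" using x by (auto simp: radical_kernel_def)
    have "?t (y \<otimes>\<^bsub>?Q\<^esub> (?K +> r)) \<in> X"
      using r y by (intro Q.trace_idealD(2)[OF X(1)] X.I_r_closed) (simp_all add: s)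
    then show ?thesis using r x by (auto simp: s)
  qed
  have "prime_trace_algebra F ?Q ?t"
  proof (intro prime_trace_algebra.intro prime_trace_algebra_axioms.intro)
    show "trace_algebra F ?Q ?t" by (rule Q.trace_algebra_axioms)
    show "carrier ?Q \<noteq> {\<zero>\<^bsub>?Q\<^esub>}"
    proof
      assume "carrier ?Q = {\<zero>\<^bsub>?Q\<^esub>}"
      then have "?K +> \<one> = ?K" by (auto simp: s)
      then have "\<one> \<in> ?K" using coset_eq_iff[OF K] by simp
      then have "\<one> \<in> I" using Int one_mem_tr_image by blast
      then have "I = carrier (trace_ring R t)" using I.one_imp_carrier by simp
      then show False using I.I_notcarr by simp
    qed
    fix X Y assume X: "trace_ideal ?Q ?t X" and Y: "trace_ideal ?Q ?t Y"
      and XY: "ideal_prod ?Q X Y = {\<zero>\<^bsub>?Q\<^esub>}"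
    show "X = {\<zero>\<^bsub>?Q\<^esub>} \<or> Y = {\<zero>\<^bsub>?Q\<^esub>}"
    proof (rule ccontr)
      assume "\<not> ?thesis"
      then obtain a b where a: "a \<in> carrier R" "?K +> t a \<in> X" "t a \<notin> I"
        and b: "b \<in> carrier R" "?K +> t b \<in> Y" "t b \<notin> I"
        using tr_nonzero X Y by meson
      have "(?K +> t a) \<otimes>\<^bsub>?Q\<^esub> (?K +> t b) \<in> {\<zero>\<^bsub>?Q\<^esub>}"
        unfolding XY[symmetric] by (intro ideal_prod.prod a b)
      then have "t a \<otimes> t b \<in> ?K" using a b by (simp add: s coset_eq_iff[OF K])
      moreover have "t a \<otimes> t b \<in> t ` carrier R" using tr_image_absorb(4)[OF imageI] a b by simp
      ultimately have "t a \<otimes> t b \<in> I" using Int by blast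
      then show False using I.I_prime[of "t a" "t b"] a b by simp
    qed
  qed
  then show ?thesis using K by (simp add: prime_trace_ideal_def)
qed

lemma ideal_Int_tr_image:
  assumes "ideal I R"
  shows "ideal (I \<inter> t ` carrier R) (trace_ring R t)"
proof -
  interpret I: ideal I R by (rule assms)
  interpret T: cring "trace_ring R t" by (rule cring_trace_ring)
  show ?thesis
  proof (rule idealI)
    show "subgroup (I \<inter> t ` carrier R) (add_monoid (trace_ring R t))"
    proof (rule T.add.subgroupI)
      show "I \<inter> t ` carrier R \<subseteq> carrier (trace_ring R t)" by simp
      show "I \<inter> t ` carrier R \<noteq> {}"
        using additive_subgroup.zero_closed[OF I.additive_subgroup_axioms] T.zero_closed
        unfolding trace_ring_simps by blast
      fix x assume x: "x \<in> I \<inter> t ` carrier R"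
      \<comment> \<open>The negative in \<open>trace_ring R t\<close> is defined through its own
        carrier. Writing it as a product with a trace moves the question to the multiplication,
        which is that of \<open>R\<close>.\<close>
      have "\<ominus>\<^bsub>trace_ring R t\<^esub> x = \<ominus>\<^bsub>trace_ring R t\<^esub> \<one> \<otimes> x" 
        using T.l_minus[of \<one> x] x T.one_closed I.Icarr by simp
      moreover have "\<ominus>\<^bsub>trace_ring R t\<^esub> \<one> \<in> t ` carrier R"
        using T.a_inv_closed[OF T.one_closed] by simp
      ultimately have "\<ominus>\<^bsub>trace_ring R t\<^esub> x \<in> I"
        using x I.I_l_closed[of x] tr_image_absorb(1)[OF _ M.one_closed] by (metis IntD1)
      then show "\<ominus>\<^bsub>trace_ring R t\<^esub> x \<in> I \<inter> t ` carrier R" using x T.a_inv_closed[of x] by simp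
      fix y assume y: "y \<in> I \<inter> t ` carrier R"
      show "x \<oplus>\<^bsub>trace_ring R t\<^esub> y \<in> I \<inter> t ` carrier R"
        using x y T.a_closed[of x y] by simp
    qed
    fix a x assume a: "a \<in> I \<inter> t ` carrier R" and x: "x \<in> carrier (trace_ring R t)"
    then have "x \<in> carrier R" by auto
    then show "x \<otimes>\<^bsub>trace_ring R t\<^esub> a \<in> I \<inter> t ` carrier R" "a \<otimes>\<^bsub>trace_ring R t\<^esub> x \<in> I \<inter> t ` carrier R"
      using a x T.m_closed[of x a] T.m_closed[of a x] by (simp_all add: I.I_l_closed I.I_r_closed)
  qed (rule T.ring_axioms)
qed

text \<open>Classes of traces are traces of the quotient, where
  \<open>tr_image_no_zero_divisors\<close> holds. The contraction is proper because
  \<open>\<one>\<close> is a trace and the quotient is nonzero.\<close>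

lemma primeideal_Int_tr_image:
  assumes "prime_trace_ideal F R t P"
  shows "primeideal (P \<inter> t ` carrier R) (trace_ring R t)"
proof (rule primeidealI)
  let ?Q = "quot_algebra R P"
  have P: "trace_ideal R t P" using assms by (simp add: prime_trace_ideal_def)
  interpret P: ideal P R using trace_idealD(1)[OF P] .
  interpret Q: prime_trace_algebra F ?Q "quot_trace R t P"
    using assms by (simp add: prime_trace_ideal_def)
  note s = quot_algebra_simps[OF P]
  show "ideal (P \<inter> t ` carrier R) (trace_ring R t)" by (rule ideal_Int_tr_image[OF P.is_ideal])
  show "cring (trace_ring R t)" by (rule cring_trace_ring)
  show "carrier (trace_ring R t) \<noteq> P \<inter> t ` carrier R"
  proof
    assume "carrier (trace_ring R t) = P \<inter> t ` carrier R"
    then have "\<one> \<in> P" using one_mem_tr_image by auto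
    then have "P = carrier R" by (rule P.one_imp_carrier)
    then have "P +> x = P" if "x \<in> carrier R" for x using coset_eq_iff[OF P that] that by simp
    then have "carrier ?Q = {P}" unfolding s(1) using M.one_closed by blast
    then have "carrier ?Q = {\<zero>\<^bsub>?Q\<^esub>}" by (simp only: s(3))
    then show False using Q.nonzero by simp
  qed
  fix a b assume "a \<in> carrier (trace_ring R t)" "b \<in> carrier (trace_ring R t)"
    and ab: "a \<otimes>\<^bsub>trace_ring R t\<^esub> b \<in> P \<inter> t ` carrier R"
  then obtain x y where x: "x \<in> carrier R" "a = t x" and y: "y \<in> carrier R" "b = t y" by auto
  have "P +> t z \<in> quot_trace R t P ` carrier ?Q" if "z \<in> carrier R" for z
    using that by (intro image_eqI[of _ _ "P +> z"]) (simp_all add: s)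
  moreover have "(P +> t x) \<otimes>\<^bsub>?Q\<^esub> (P +> t y) = \<zero>\<^bsub>?Q\<^esub>"
    using ab x y by (simp add: s coset_eq_iff[OF P])
  ultimately have "P +> t x = \<zero>\<^bsub>?Q\<^esub> \<or> P +> t y = \<zero>\<^bsub>?Q\<^esub>"
    using Q.tr_image_no_zero_divisors[of "P +> t x" "P +> t y"] x(1) y(1) by simp
  then show "a \<in> P \<inter> t ` carrier R \<or> b \<in> P \<inter> t ` carrier R"
    using x y by (simp add: s coset_eq_iff[OF P])
qed

text \<open>Every \<open>t (x \<otimes> y)\<close> is a trace, so contracting \<open>P\<close> does
  not change its radical kernel; by the Cayley-Hamilton identity and primeness this kernel is
  \<open>P\<close>.\<close>

lemma radical_kernel_prime_Int:
  assumes "prime_trace_ideal F R t P"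
  shows "radical_kernel R t (P \<inter> t ` carrier R) = P"
proof -
  have P: "trace_ideal R t P" using assms by (simp add: prime_trace_ideal_def)
  interpret P: ideal P R using trace_idealD(1)[OF P] .
  have "radical_kernel R t (P \<inter> t ` carrier R) = radical_kernel R t P"
    by (auto simp: radical_kernel_def)
  moreover have "P \<subseteq> radical_kernel R t P"
    unfolding radical_kernel_def by (blast intro: trace_idealD(2)[OF P] P.Icarr P.I_r_closed)
  ultimately show ?thesis using radical_kernel_prime_trace_ideal[OF assms] by blast
qed

end

subsection \<open>The homeomorphism of spectra\<close>

theorem theorem11p2p1:
  fixes F :: "('k, 'l) ring_scheme" and R :: "('k, 'a, 'm) module_scheme"
    and t :: "'a \<Rightarrow> 'a" and n :: nat
  assumes "cayley_hamilton_algebra F R t n"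
  shows "homeomorphic_maps (Spec_t F R t) (Spec (trace_ring R t))
           (\<lambda>P. P \<inter> carrier (trace_ring R t))
           (\<lambda>\<pp>. radical_kernel R t (ideal_prod R \<pp> (carrier R)))"
proof -
  interpret cayley_hamilton_algebra F R t n by (rule assms)
  let ?T = "trace_ring R t"
  interpret T: cring ?T by (rule cring_trace_ring)
  note cl = closedin_Spec_t closedin_Spec[OF T.ring_axioms]
  have prod: "radical_kernel R t (ideal_prod R \<pp> (carrier R)) = radical_kernel R t \<pp>"
    if "primeideal \<pp> ?T" for \<pp>
    using radical_kernel_ideal_prod primeideal.axioms(1)[OF that] .
  have "continuous_map (Spec_t F R t) (Spec ?T) (\<lambda>P. P \<inter> carrier ?T)"
    unfolding continuous_map_closedin
  proof (intro conjI allI impI)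
    show "(\<lambda>P. P \<inter> carrier ?T) \<in> topspace (Spec_t F R t) \<rightarrow> topspace (Spec ?T)"
      using primeideal_Int_tr_image by (auto simp: cl)
    fix C assume "closedin (Spec ?T) C"
    then obtain I where I: "ideal I ?T" "C = {\<pp>. primeideal \<pp> ?T \<and> I \<subseteq> \<pp>}"
      unfolding cl by blast
    \<comment> \<open>The trace ideal generated by \<open>I\<close>; \<open>carrier R\<close> keeps
      the intersected family nonempty.\<close>
    define J where "J = \<Inter>{J. trace_ideal R t J \<and> I \<subseteq> J}"
    have "trace_ideal R t (carrier R)" using M.oneideal by (auto simp: trace_ideal_def)
    moreover have "I \<subseteq> carrier R" using ideal_trace_ringD(3)[OF I(1)] by blast
    ultimately have "trace_ideal R t J"
      using M.i_Intersect[of "{J. trace_ideal R t J \<and> I \<subseteq> J}"]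
      unfolding J_def trace_ideal_def by blast
    moreover have "J \<subseteq> P \<longleftrightarrow> I \<subseteq> P" if "prime_trace_ideal F R t P" for P
      using that unfolding J_def prime_trace_ideal_def by blast
    moreover have "I \<subseteq> t ` carrier R" using ideal_trace_ringD(2)[OF I(1)] by blast
    ultimately show "closedin (Spec_t F R t) {P \<in> topspace (Spec_t F R t). P \<inter> carrier ?T \<in> C}"
      unfolding cl I(2) using primeideal_Int_tr_image by (intro exI[of _ J]) auto
  qed
  moreover have "continuous_map (Spec ?T) (Spec_t F R t)
      (\<lambda>\<pp>. radical_kernel R t (ideal_prod R \<pp> (carrier R)))"
    unfolding continuous_map_closedin
  proof (intro conjI allI impI)
    show "(\<lambda>\<pp>. radical_kernel R t (ideal_prod R \<pp> (carrier R))) \<in>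
        topspace (Spec ?T) \<rightarrow> topspace (Spec_t F R t)"
      using prime_trace_ideal_radical_kernel prod by (auto simp: cl)
    fix C assume "closedin (Spec_t F R t) C"
    then obtain I where I: "trace_ideal R t I" "C = {P. prime_trace_ideal F R t P \<and> I \<subseteq> P}"
      unfolding cl by blast
    interpret I: ideal I R using trace_idealD(1)[OF I(1)] .
    \<comment> \<open>This makes the preimage of the closed set of \<open>I\<close> the closed set
      of its contraction. For the reverse direction, \<open>t (x \<otimes> y)\<close> with
      \<open>x\<close> in \<open>I\<close> is a trace lying in \<open>I\<close>.\<close>
    have "I \<subseteq> radical_kernel R t \<pp> \<longleftrightarrow> I \<inter> t ` carrier R \<subseteq> \<pp>" if "primeideal \<pp> ?T" for \<pp>
    proof
      assume "I \<subseteq> radical_kernel R t \<pp>"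
      then show "I \<inter> t ` carrier R \<subseteq> \<pp>"
        using radical_kernel_Int_tr_image[OF primeideal.axioms(1)[OF that]] by blast
    next
      assume "I \<inter> t ` carrier R \<subseteq> \<pp>"
      then show "I \<subseteq> radical_kernel R t \<pp>"
        using trace_idealD(2)[OF I(1)] I.Icarr I.I_r_closed
        by (fastforce simp: radical_kernel_def)
    qed
    then have "{\<pp> \<in> topspace (Spec ?T). radical_kernel R t (ideal_prod R \<pp> (carrier R)) \<in> C} =
        {\<pp>. primeideal \<pp> ?T \<and> I \<inter> t ` carrier R \<subseteq> \<pp>}"
      unfolding cl I(2) by (simp add: prod prime_trace_ideal_radical_kernel cong: conj_cong)
    then show "closedin (Spec ?T)
        {\<pp> \<in> topspace (Spec ?T). radical_kernel R t (ideal_prod R \<pp> (carrier R)) \<in> C}"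
      unfolding cl(3) using ideal_Int_tr_image[OF I.is_ideal] by blast
  qed
  moreover have "radical_kernel R t (ideal_prod R (P \<inter> carrier ?T) (carrier R)) = P"
    if "prime_trace_ideal F R t P" for P
    using prod[OF primeideal_Int_tr_image[OF that]] radical_kernel_prime_Int[OF that] by simp
  moreover have "radical_kernel R t (ideal_prod R \<pp> (carrier R)) \<inter> carrier ?T = \<pp>"
    if "primeideal \<pp> ?T" for \<pp>
    using prod[OF that] radical_kernel_Int_tr_image[OF primeideal.axioms(1)[OF that]] by simp
  ultimately show ?thesis
    unfolding homeomorphic_maps_def cl by blast
qed

end
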